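(* Let $X$ be a compact metric space and $\varphi:\mathbb{T}^+\times X\to X$ a dynamical system. The set $\mathsf{Rep}(\varphi)$ of repellers is a sublattice of the lattice $\mathsf{Invset}^{\pm}(\varphi)$ of forward-backward invariant sets, and the mapping $\alpha:\mathsf{RNbhd}(\varphi)\to\mathsf{Rep}(\varphi)$, $U\mapsto\alpha(U)$, is a surjective lattice homomorphism.
   Context: $\mathbb{T}$ is $\mathbb{Z}$ or $\mathbb{R}$, $\mathbb{T}^+=\{t\in\mathbb{T}:t\ge0\}$. A dynamical system is a continuous map $\varphi:\mathbb{T}^+\times X\to X$ with $\varphi(0,x)=x$ and $\varphi(t,\varphi(s,x))=\varphi(t+s,x)$ for $s,t\in\mathbb{T}^+$ (no invertibility assumed). For $t<0$ and $S\subset X$, $\varphi(t,S)=\{y\in X:\varphi(-t,y)\in S\}$. $S\subset X$ is forward invariant if $\varphi(t,S)\subset S$ for all $t\ge0$, backward invariant if $\varphi(t,S)\subset S$ for all $t\le0$, and forward-backward invariant if both hold. $\mathsf{Invset}^{\pm}(\varphi)$ is the set of forward-backward invariant sets, a bounded distributive lattice under $\vee=\cup$, $\wedge=\cap$, $0=\varnothing$, $1=X$. $\mathrm{Inv}^+(U)$ is the union of all forward invariant subsets of $U$. For $U\subset X$, $\alpha(U)=\bigcap_{t\le0}\mathrm{cl}\big(\bigcup_{s\le t}\varphi(s,U)\big)$. $U\subset X$ is a repelling neighborhood if $\alpha(U)\subset\mathrm{int}(U)$; the set $\mathsf{RNbhd}(\varphi)$ of repelling neighborhoods is a bounded distributive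 lattice under $\cup,\cap$ with $0=\varnothing$, $1=X$. A repelling region is a backward invariant $U\subset X$ with $\varphi(\tau,\mathrm{cl}(U))\subset\mathrm{int}(U)$ for some $\tau<0$; a repeller is a set $\mathrm{Inv}^+(U)$ with $U$ a repelling region. Sublattices of bounded lattices must contain $0$ and $1$; homomorphisms of bounded lattices must preserve $0$ and $1$. *)

theory Defs
  imports "HOL-Analysis.Analysis"
begin

text \<open>
  The time set \<open>T\<close> is a subset of the reals, to be instantiated with \<open>\<int>\<close> or \<open>UNIV\<close>; times \<open>t\<close>
  range over \<open>T\<close> throughout. For \<open>T = \<int>\<close> the subspace topology on \<open>T\<close> is discrete.
  The phase space is \<open>topspace X\<close>, so closures and interiors are relative to it; values of
  \<open>\<phi>\<close> outside \<open>nonneg T \<times> topspace X\<close> are irrelevant.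
\<close>

definition nonneg :: "real set \<Rightarrow> real set" where
  "nonneg T = {t \<in> T. 0 \<le> t}"

definition dynamical_system :: "real set \<Rightarrow> 'a topology \<Rightarrow> (real \<Rightarrow> 'a \<Rightarrow> 'a) \<Rightarrow> bool" where
  "dynamical_system T X \<phi> \<longleftrightarrow>
     continuous_map (prod_topology (top_of_set (nonneg T)) X) X (\<lambda>(t, x). \<phi> t x) \<and>
     (\<forall>x \<in> topspace X. \<phi> 0 x = x) \<and>
     (\<forall>s \<in> nonneg T. \<forall>t \<in> nonneg T. \<forall>x \<in> topspace X. \<phi> t (\<phi> s x) = \<phi> (t + s) x)"

text \<open>The set \<open>\<phi>(t, S)\<close>: an image for \<open>t \<ge> 0\<close>, a preimage under \<open>\<phi>(-t, \<cdot>)\<close> for \<open>t < 0\<close>.\<close>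

definition set_flow :: "'a topology \<Rightarrow> (real \<Rightarrow> 'a \<Rightarrow> 'a) \<Rightarrow> real \<Rightarrow> 'a set \<Rightarrow> 'a set" where
  "set_flow X \<phi> t S = (if 0 \<le> t then \<phi> t ` S else {y \<in> topspace X. \<phi> (- t) y \<in> S})"

definition forward_invariant ::
    "real set \<Rightarrow> 'a topology \<Rightarrow> (real \<Rightarrow> 'a \<Rightarrow> 'a) \<Rightarrow> 'a set \<Rightarrow> bool" where
  "forward_invariant T X \<phi> S \<longleftrightarrow>
     S \<subseteq> topspace X \<and> (\<forall>t \<in> T. 0 \<le> t \<longrightarrow> set_flow X \<phi> t S \<subseteq> S)"

definition backward_invariant ::
    "real set \<Rightarrow> 'a topology \<Rightarrow> (real \<Rightarrow> 'a \<Rightarrow> 'a) \<Rightarrow> 'a set \<Rightarrow> bool" where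
  "backward_invariant T X \<phi> S \<longleftrightarrow>
     S \<subseteq> topspace X \<and> (\<forall>t \<in> T. t \<le> 0 \<longrightarrow> set_flow X \<phi> t S \<subseteq> S)"

definition Invset_pm :: "real set \<Rightarrow> 'a topology \<Rightarrow> (real \<Rightarrow> 'a \<Rightarrow> 'a) \<Rightarrow> 'a set set" where
  "Invset_pm T X \<phi> = {S. forward_invariant T X \<phi> S \<and> backward_invariant T X \<phi> S}"

definition Inv_plus ::
    "real set \<Rightarrow> 'a topology \<Rightarrow> (real \<Rightarrow> 'a \<Rightarrow> 'a) \<Rightarrow> 'a set \<Rightarrow> 'a set" where
  "Inv_plus T X \<phi> U = \<Union>{S. S \<subseteq> U \<and> forward_invariant T X \<phi> S}"

definition alpha_limit ::
    "real set \<Rightarrow> 'a topology \<Rightarrow> (real \<Rightarrow> 'a \<Rightarrow> 'a) \<Rightarrow> 'a set \<Rightarrow> 'a set" where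
  "alpha_limit T X \<phi> U =
     (\<Inter>t \<in> {t \<in> T. t \<le> 0}. X closure_of (\<Union>s \<in> {s \<in> T. s \<le> t}. set_flow X \<phi> s U))"

definition RNbhd :: "real set \<Rightarrow> 'a topology \<Rightarrow> (real \<Rightarrow> 'a \<Rightarrow> 'a) \<Rightarrow> 'a set set" where
  "RNbhd T X \<phi> = {U. U \<subseteq> topspace X \<and> alpha_limit T X \<phi> U \<subseteq> X interior_of U}"

definition repelling_region ::
    "real set \<Rightarrow> 'a topology \<Rightarrow> (real \<Rightarrow> 'a \<Rightarrow> 'a) \<Rightarrow> 'a set \<Rightarrow> bool" where
  "repelling_region T X \<phi> U \<longleftrightarrow>
     backward_invariant T X \<phi> U \<and>
     (\<exists>\<tau> \<in> T. \<tau> < 0 \<and> set_flow X \<phi> \<tau> (X closure_of U) \<subseteq> X interior_of U)"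

definition Rep :: "real set \<Rightarrow> 'a topology \<Rightarrow> (real \<Rightarrow> 'a \<Rightarrow> 'a) \<Rightarrow> 'a set set" where
  "Rep T X \<phi> = {Inv_plus T X \<phi> U | U. repelling_region T X \<phi> U}"

text \<open>
  Bounded lattices of subsets of \<open>E\<close>, with \<open>\<or> = \<union>\<close>, \<open>\<and> = \<inter>\<close>, \<open>0 = {}\<close>, \<open>1 = E\<close>;
  distributivity is automatic.
\<close>

definition set_lattice :: "'a set \<Rightarrow> 'a set set \<Rightarrow> bool" where
  "set_lattice E L \<longleftrightarrow>
     L \<subseteq> Pow E \<and> {} \<in> L \<and> E \<in> L \<and> (\<forall>A \<in> L. \<forall>B \<in> L. A \<union> B \<in> L \<and> A \<inter> B \<in> L)"

definition set_sublattice :: "'a set \<Rightarrow> 'a set set \<Rightarrow> 'a set set \<Rightarrow> bool" where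
  "set_sublattice E K L \<longleftrightarrow> set_lattice E L \<and> K \<subseteq> L \<and> set_lattice E K"

definition set_lattice_hom ::
    "'a set \<Rightarrow> 'a set set \<Rightarrow> 'a set set \<Rightarrow> ('a set \<Rightarrow> 'a set) \<Rightarrow> bool" where
  "set_lattice_hom E L L' f \<longleftrightarrow>
     set_lattice E L \<and> set_lattice E L' \<and> f \<in> L \<rightarrow> L' \<and> f {} = {} \<and> f E = E \<and>
     (\<forall>A \<in> L. \<forall>B \<in> L. f (A \<union> B) = f A \<union> f B \<and> f (A \<inter> B) = f A \<inter> f B)"

end

theory Submission
  imports Defs
begin

text \<open>
  The limit set \<open>\<alpha>(U)\<close> is always forward invariant. If moreover \<open>\<alpha>(U) \<subseteq> int(U)\<close>, it therefore
  equals \<open>Inv\<^sup>+(U)\<close>, which also coincides with the set of points whose orbit eventually stays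
  in \<open>U\<close>; from this description backward invariance and compatibility with intersections are
  immediate. By compactness some \<open>V = \<Union>{\<phi>(s, U) | s \<le> t}\<close> with \<open>t < 0\<close> has its closure in \<open>int(U)\<close>;
  this \<open>V\<close> is a repelling region with \<open>Inv\<^sup>+(V) = \<alpha>(U)\<close>. Conversely every repelling region is a
  repelling neighborhood.
\<close>

text \<open>The integers and the reals are treated together as a time set that is an additive
  subgroup of the reals containing 1. The element 1 puts all natural numbers into \<open>T\<close>,
  which supplies a sequence of times tending to infinity.\<close>

locale dyn_system =
  fixes T :: "real set" and X :: "'a topology" and \<phi> :: "real \<Rightarrow> 'a \<Rightarrow> 'a"
  assumes zero_in_T: "0 \<in> T" and one_in_T: "1 \<in> T"
    and add_in_T: "s \<in> T \<Longrightarrow> t \<in> T \<Longrightarrow> s + t \<in> T"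
    and minus_in_T: "t \<in> T \<Longrightarrow> - t \<in> T"
    and dynamical_system: "dynamical_system T X \<phi>"
begin

section \<open>Time arithmetic and the semiflow\<close>

lemma diff_in_T: "s \<in> T \<Longrightarrow> t \<in> T \<Longrightarrow> s - t \<in> T"
  using add_in_T[of s "- t"] minus_in_T[of t] by simp

lemma of_nat_in_T: "real n \<in> T"
  by (induction n) (auto simp: zero_in_T one_in_T intro: add_in_T)

lemma flow_zero: "x \<in> topspace X \<Longrightarrow> \<phi> 0 x = x"
  using dynamical_system unfolding dynamical_system_def by blast

lemma flow_flow:
  "\<lbrakk>s \<in> T; 0 \<le> s; t \<in> T; 0 \<le> t; x \<in> topspace X\<rbrakk> \<Longrightarrow> \<phi> t (\<phi> s x) = \<phi> (t + s) x"
  using dynamical_system unfolding dynamical_system_def nonneg_def by blast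

lemma continuous_map_flow:
  assumes "t \<in> T" "0 \<le> t"
  shows "continuous_map X X (\<phi> t)"
proof -
  have "continuous_map (prod_topology (top_of_set (nonneg T)) X) X (\<lambda>(t, x). \<phi> t x)"
    using dynamical_system unfolding dynamical_system_def by blast
  moreover have "continuous_map X (prod_topology (top_of_set (nonneg T)) X) (\<lambda>x. (t, x))"
    using assms by (auto simp: continuous_map_pairwise o_def nonneg_def)
  ultimately show ?thesis
    using continuous_map_compose[of X _ "\<lambda>x. (t, x)" X "\<lambda>(t, x). \<phi> t x"] by (simp add: o_def)
qed

lemma flow_in_topspace:
  "\<lbrakk>t \<in> T; 0 \<le> t; x \<in> topspace X\<rbrakk> \<Longrightarrow> \<phi> t x \<in> topspace X"
  using continuous_map_flow by (auto simp: continuous_map_def)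

section \<open>Invariance in terms of forward orbits\<close>

text \<open>At time 0 the image equals the preimage because \<open>\<phi> 0\<close> is the identity
  on the phase space, so the preimage formula extends from negative times to time 0.\<close>

lemma set_flow_nonpos:
  assumes "U \<subseteq> topspace X" "t \<le> 0"
  shows "set_flow X \<phi> t U = {y \<in> topspace X. \<phi> (- t) y \<in> U}"
  using assms flow_zero by (force simp: set_flow_def)

lemma forward_invariant_iff:
  "forward_invariant T X \<phi> S \<longleftrightarrow>
     S \<subseteq> topspace X \<and> (\<forall>t \<in> T. 0 \<le> t \<longrightarrow> (\<forall>x \<in> S. \<phi> t x \<in> S))"
  by (auto simp: forward_invariant_def set_flow_def)

lemma backward_invariant_iff:
  "backward_invariant T X \<phi> S \<longleftrightarrow>
     S \<subseteq> topspace X \<and> (\<forall>t \<in> T. 0 \<le> t \<longrightarrow> (\<forall>x \<in> topspace X. \<phi> t x \<in> S \<longrightarrow> x \<in> S))"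
proof (cases "S \<subseteq> topspace X")
  case True
  then have "backward_invariant T X \<phi> S \<longleftrightarrow>
      (\<forall>t \<in> T. t \<le> 0 \<longrightarrow> (\<forall>x \<in> topspace X. \<phi> (- t) x \<in> S \<longrightarrow> x \<in> S))"
    by (auto simp: backward_invariant_def set_flow_nonpos)
  also have "\<dots> \<longleftrightarrow> (\<forall>t \<in> T. 0 \<le> t \<longrightarrow> (\<forall>x \<in> topspace X. \<phi> t x \<in> S \<longrightarrow> x \<in> S))"
    using minus_in_T by (metis minus_minus neg_0_le_iff_le neg_le_0_iff_le)
  finally show ?thesis using True by simp
qed (simp add: backward_invariant_def)

text \<open>By the semigroup law, the points whose whole forward orbit lies in \<open>U\<close> form
  a forward invariant set; time 0 places it inside \<open>U\<close>, and every other forward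
  invariant subset of \<open>U\<close> is contained in it.\<close>

lemma Inv_plus_eq:
  assumes "U \<subseteq> topspace X"
  shows "Inv_plus T X \<phi> U = {x \<in> topspace X. \<forall>t \<in> T. 0 \<le> t \<longrightarrow> \<phi> t x \<in> U}" (is "_ = ?I")
proof
  show "Inv_plus T X \<phi> U \<subseteq> ?I"
    unfolding Inv_plus_def forward_invariant_iff by blast
  have "?I \<subseteq> U"
    using flow_zero zero_in_T by fastforce
  moreover have "forward_invariant T X \<phi> ?I"
    unfolding forward_invariant_iff
    by (auto simp: flow_flow flow_in_topspace add_in_T)
  ultimately show "?I \<subseteq> Inv_plus T X \<phi> U"
    unfolding Inv_plus_def by blast
qed

section \<open>The limit set and its general properties\<close>

text \<open>For \<open>t \<ge> 0\<close> this is the union of the sets \<open>\<phi>(s, U)\<close>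
  over \<open>s \<le> -t\<close>, with the sign of time reversed so that only forward orbits
  occur.\<close>

definition past :: "real \<Rightarrow> 'a set \<Rightarrow> 'a set" where
  "past t U = {y \<in> topspace X. \<exists>s \<in> T. t \<le> s \<and> \<phi> s y \<in> U}"

lemma past_subset_topspace: "past t U \<subseteq> topspace X"
  by (auto simp: past_def)

lemma past_antimono: "s \<le> t \<Longrightarrow> past t U \<subseteq> past s U"
  unfolding past_def by (blast intro: order_trans)

lemma past_mono: "U \<subseteq> V \<Longrightarrow> past t U \<subseteq> past t V"
  by (auto simp: past_def)

lemma past_Un: "past t (U \<union> V) = past t U \<union> past t V"
  by (auto simp: past_def)

lemma alpha_limit_eq:
  assumes "U \<subseteq> topspace X"
  shows "alpha_limit T X \<phi> U = (\<Inter>t \<in> nonneg T. X closure_of past t U)"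
proof -
  have *: "(\<Union>s \<in> {s \<in> T. s \<le> t}. set_flow X \<phi> s U) = past (- t) U" if "t \<le> 0" for t
  proof -
    have "(\<Union>s \<in> {s \<in> T. s \<le> t}. set_flow X \<phi> s U)
        = {y \<in> topspace X. \<exists>s \<in> T. s \<le> t \<and> \<phi> (- s) y \<in> U}"
      using assms that by (auto simp: set_flow_nonpos)
    also have "\<dots> = past (- t) U"
    proof -
      have "(\<exists>s \<in> T. s \<le> t \<and> \<phi> (- s) y \<in> U) \<longleftrightarrow> (\<exists>s \<in> T. - t \<le> s \<and> \<phi> s y \<in> U)" for y
        using minus_in_T by (metis minus_le_iff minus_minus neg_le_iff_le)
      then show ?thesis
        unfolding past_def by simp
    qed
    finally show ?thesis .
  qed
  \<comment> \<open>The two intersections are matched by the substitution of \<open>-t\<close> for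
    \<open>t\<close>.\<close>
  have "nonneg T = uminus ` {t \<in> T. t \<le> 0}"
  proof
    show "nonneg T \<subseteq> uminus ` {t \<in> T. t \<le> 0}"
    proof
      fix t assume "t \<in> nonneg T"
      then show "t \<in> uminus ` {t \<in> T. t \<le> 0}"
        using minus_in_T by (intro image_eqI[of _ _ "- t"]) (auto simp: nonneg_def)
    qed
  qed (use minus_in_T in \<open>auto simp: nonneg_def\<close>)
  then show ?thesis
    by (simp add: alpha_limit_def * image_image)
qed

lemma alpha_limit_mono:
  assumes "U \<subseteq> V" "V \<subseteq> topspace X"
  shows "alpha_limit T X \<phi> U \<subseteq> alpha_limit T X \<phi> V"
  using assms closure_of_mono[OF past_mono[OF assms(1)]] by (fastforce simp: alpha_limit_eq)

text \<open>A point outside both limit sets misses the closure of \<open>past s U\<close> for one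
  time and of \<open>past t V\<close> for another. As \<open>past\<close> shrinks when its time
  grows, \<open>max s t\<close> serves both sets at once, and closure commutes with finite
  unions.\<close>

lemma alpha_limit_Un:
  assumes "U \<subseteq> topspace X" "V \<subseteq> topspace X"
  shows "alpha_limit T X \<phi> (U \<union> V) = alpha_limit T X \<phi> U \<union> alpha_limit T X \<phi> V"
proof
  show "alpha_limit T X \<phi> U \<union> alpha_limit T X \<phi> V \<subseteq> alpha_limit T X \<phi> (U \<union> V)"
    using assms by (simp add: alpha_limit_mono)
  show "alpha_limit T X \<phi> (U \<union> V) \<subseteq> alpha_limit T X \<phi> U \<union> alpha_limit T X \<phi> V"
  proof (rule ccontr)
    assume "\<not> ?thesis"
    then obtain x where x: "x \<in> alpha_limit T X \<phi> (U \<union> V)"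
      and "x \<notin> alpha_limit T X \<phi> U" "x \<notin> alpha_limit T X \<phi> V"
      by blast
    then obtain s t where st: "s \<in> nonneg T" "t \<in> nonneg T"
      and n: "x \<notin> X closure_of past s U" "x \<notin> X closure_of past t V"
      using assms unfolding alpha_limit_eq[OF assms(1)] alpha_limit_eq[OF assms(2)] by blast
    have "max s t \<in> nonneg T"
      using st by (simp add: max_def)
    then have "x \<in> X closure_of (past (max s t) U \<union> past (max s t) V)"
      using x assms by (auto simp: alpha_limit_eq past_Un)
    then have "x \<in> X closure_of past s U \<union> X closure_of past t V"
      using closure_of_mono[OF past_antimono[of s "max s t" U], of X]
        closure_of_mono[OF past_antimono[of t "max s t" V], of X]
      by (auto simp: closure_of_Un)
    with n show False by simp
  qed
qed

text \<open>Every \<open>past t {}\<close> is empty, and \<open>0 \<in> T\<close> ensures that the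
  intersection has a member.\<close>

lemma alpha_limit_empty: "alpha_limit T X \<phi> {} = {}"
  using zero_in_T by (auto simp: alpha_limit_eq past_def nonneg_def)

text \<open>Such a point lies in each \<open>past t U\<close> itself, before taking closures: time
  \<open>max r t\<close> is a witness. This is the membership test for limit sets used
  below.\<close>

lemma eventually_in_imp_alpha_limit:
  assumes "U \<subseteq> topspace X" "x \<in> topspace X" "r \<in> T"
    and "\<And>s. \<lbrakk>s \<in> T; r \<le> s\<rbrakk> \<Longrightarrow> \<phi> s x \<in> U"
  shows "x \<in> alpha_limit T X \<phi> U"
proof -
  have "x \<in> X closure_of past t U" if "t \<in> nonneg T" for t
  proof -
    have "max r t \<in> T"
      using assms that by (simp add: max_def nonneg_def)
    then have "x \<in> past t U"
      using assms unfolding past_def by (metis (mono_tags, lifting) CollectI max.cobounded1 max.cobounded2)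
    then show ?thesis
      using closure_of_subset[OF past_subset_topspace] by blast
  qed
  then show ?thesis
    using assms by (simp add: alpha_limit_eq)
qed

lemma alpha_limit_topspace: "alpha_limit T X \<phi> (topspace X) = topspace X"
proof
  show "alpha_limit T X \<phi> (topspace X) \<subseteq> topspace X"
    using zero_in_T closure_of_subset_topspace[of X "past 0 (topspace X)"]
    by (auto simp: alpha_limit_eq nonneg_def)
  show "topspace X \<subseteq> alpha_limit T X \<phi> (topspace X)"
    using eventually_in_imp_alpha_limit[of "topspace X" _ 0] zero_in_T flow_in_topspace by blast
qed

text \<open>Flowing for time \<open>r\<close> uses up \<open>r\<close> units of the waiting time, so
  \<open>\<phi> r\<close> maps \<open>past (t + r) U\<close> into \<open>past t U\<close>;
  continuity carries this inclusion over to the closures.\<close>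

lemma forward_invariant_alpha_limit:
  assumes "U \<subseteq> topspace X"
  shows "forward_invariant T X \<phi> (alpha_limit T X \<phi> U)"
  unfolding forward_invariant_iff
proof (intro conjI ballI impI)
  show "alpha_limit T X \<phi> U \<subseteq> topspace X"
    using alpha_limit_mono[OF assms] alpha_limit_topspace by simp
next
  fix r x assume r: "r \<in> T" "0 \<le> r" and x: "x \<in> alpha_limit T X \<phi> U"
  have "\<phi> r x \<in> X closure_of past t U" if t: "t \<in> nonneg T" for t
  proof -
    have "\<phi> r ` past (t + r) U \<subseteq> past t U"
    proof
      fix z assume "z \<in> \<phi> r ` past (t + r) U"
      then obtain y s where y: "z = \<phi> r y" "y \<in> topspace X" "s \<in> T" "t + r \<le> s" "\<phi> s y \<in> U"
        by (auto simp: past_def)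
      have "\<phi> (s - r) z \<in> U"
        using y r t flow_flow[of r "s - r" y] by (simp add: diff_in_T nonneg_def)
      moreover have "z \<in> topspace X" "s - r \<in> T" "t \<le> s - r"
        using y r by (auto simp: flow_in_topspace diff_in_T)
      ultimately show "z \<in> past t U"
        unfolding past_def by blast
    qed
    then have "X closure_of \<phi> r ` past (t + r) U \<subseteq> X closure_of past t U"
      by (rule closure_of_mono)
    moreover have "x \<in> X closure_of past (t + r) U"
      using x assms r t by (auto simp: alpha_limit_eq nonneg_def add_in_T)
    moreover have "\<phi> r ` (X closure_of past (t + r) U) \<subseteq> X closure_of \<phi> r ` past (t + r) U"
      using continuous_map_flow[OF r] past_subset_topspace
      by (auto simp: continuous_map_eq_image_closure_subset)
    ultimately show ?thesis by blast
  qed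
  then show "\<phi> r x \<in> alpha_limit T X \<phi> U"
    using assms by (simp add: alpha_limit_eq)
qed

section \<open>Limit sets of repelling neighborhoods\<close>

text \<open>The limit set is forward invariant and here contained in \<open>U\<close>, hence in
  \<open>Inv_plus\<close>. Conversely, an orbit that stays in \<open>U\<close> from time 0 on passes
  the membership test.\<close>

lemma alpha_limit_eq_Inv_plus:
  assumes "U \<in> RNbhd T X \<phi>"
  shows "alpha_limit T X \<phi> U = Inv_plus T X \<phi> U"
proof
  have U: "U \<subseteq> topspace X" "alpha_limit T X \<phi> U \<subseteq> U"
    using assms interior_of_subset[of X U] by (auto simp: RNbhd_def)
  then show "alpha_limit T X \<phi> U \<subseteq> Inv_plus T X \<phi> U"
    using forward_invariant_alpha_limit unfolding Inv_plus_def by blast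
  show "Inv_plus T X \<phi> U \<subseteq> alpha_limit T X \<phi> U"
    using U eventually_in_imp_alpha_limit[of U _ 0] zero_in_T by (auto simp: Inv_plus_eq)
qed

lemma alpha_limit_in_Invset_pm:
  assumes "U \<in> RNbhd T X \<phi>"
  shows "alpha_limit T X \<phi> U \<in> Invset_pm T X \<phi>"
proof -
  have U: "U \<subseteq> topspace X"
    using assms by (simp add: RNbhd_def)
  have fw: "forward_invariant T X \<phi> (alpha_limit T X \<phi> U)"
    by (rule forward_invariant_alpha_limit[OF U])
  \<comment> \<open>Backward invariance: if \<open>\<phi> r x\<close> has its whole forward orbit in
    \<open>U\<close>, then the orbit of \<open>x\<close> stays in \<open>U\<close> from time
    \<open>r\<close> on.\<close>
  have "x \<in> alpha_limit T X \<phi> U"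
    if r: "r \<in> T" "0 \<le> r" and x: "x \<in> topspace X" "\<phi> r x \<in> alpha_limit T X \<phi> U" for r x
  proof (rule eventually_in_imp_alpha_limit[OF U x(1) r(1)])
    fix s assume s: "s \<in> T" "r \<le> s"
    have "\<phi> (s - r) (\<phi> r x) \<in> U"
      using x s r U alpha_limit_eq_Inv_plus[OF assms] by (auto simp: Inv_plus_eq diff_in_T)
    then show "\<phi> s x \<in> U"
      using flow_flow[of r "s - r" x] r s x by (simp add: diff_in_T)
  qed
  with fw show ?thesis
    by (auto simp: Invset_pm_def forward_invariant_iff backward_invariant_iff)
qed

section \<open>Repelling regions and repellers\<close>

text \<open>Backward invariance turns a visit to \<open>U\<close> at any time after
  \<open>r = -\<tau>\<close> into a visit at time \<open>r\<close> exactly. Thus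
  \<open>past r U\<close> lies in the closed preimage \<open>?P\<close>, which the choice of
  \<open>\<tau>\<close> places in the interior of \<open>U\<close>.\<close>

lemma repelling_region_imp_RNbhd:
  assumes "repelling_region T X \<phi> U"
  shows "U \<in> RNbhd T X \<phi>"
proof -
  have U: "U \<subseteq> topspace X"
    and bw: "\<And>t x. \<lbrakk>t \<in> T; 0 \<le> t; x \<in> topspace X; \<phi> t x \<in> U\<rbrakk> \<Longrightarrow> x \<in> U"
    using assms unfolding repelling_region_def backward_invariant_iff by blast+
  obtain \<tau> where "\<tau> \<in> T" "\<tau> < 0" and sub: "set_flow X \<phi> \<tau> (X closure_of U) \<subseteq> X interior_of U"
    using assms unfolding repelling_region_def by blast
  define r where "r = - \<tau>"
  have r: "r \<in> T" "0 < r"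
    using \<open>\<tau> \<in> T\<close> \<open>\<tau> < 0\<close> minus_in_T by (auto simp: r_def)
  let ?P = "{x \<in> topspace X. \<phi> r x \<in> X closure_of U}"
  have "past r U \<subseteq> ?P"
  proof
    fix y assume "y \<in> past r U"
    then obtain s where y: "y \<in> topspace X" "s \<in> T" "r \<le> s" "\<phi> s y \<in> U"
      by (auto simp: past_def)
    \<comment> \<open>The point \<open>\<phi> r y\<close> reaches \<open>U\<close> after the further
      time \<open>s - r\<close>.\<close>
    have "\<phi> r y \<in> U"
      using bw[of "s - r" "\<phi> r y"] flow_flow[of r "s - r" y] y r
      by (simp add: diff_in_T flow_in_topspace)
    then show "y \<in> ?P"
      using y closure_of_subset[OF U] by blast
  qed
  moreover have "closedin X ?P"
    using continuous_map_flow[of r] r by (intro closedin_continuous_map_preimage) auto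
  ultimately have "X closure_of past r U \<subseteq> ?P"
    by (rule closure_of_minimal)
  moreover have "?P \<subseteq> X interior_of U"
    using sub \<open>\<tau> < 0\<close> by (simp add: set_flow_def r_def)
  moreover have "alpha_limit T X \<phi> U \<subseteq> X closure_of past r U"
    using U r by (auto simp: alpha_limit_eq nonneg_def)
  ultimately show ?thesis
    using U by (auto simp: RNbhd_def)
qed

text \<open>If the closures never entered the interior of \<open>U\<close>, their remainders outside
  it would be decreasing nonempty closed sets. A common point, given by compactness, would lie in
  the limit set but not in the interior.\<close>

lemma compact_past_in_interior:
  assumes "compact_space X" "U \<in> RNbhd T X \<phi>"
  obtains t where "t \<in> T" "0 < t" "X closure_of past t U \<subseteq> X interior_of U"
proof -
  have U: "U \<subseteq> topspace X" "alpha_limit T X \<phi> U \<subseteq> X interior_of U"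
    using assms by (auto simp: RNbhd_def)
  \<comment> \<open>Natural numbers belong to \<open>T\<close> and are cofinal in time; the
    successor makes the resulting time strictly positive.\<close>
  define C where "C n = X closure_of past (real (Suc n)) U - X interior_of U" for n
  have "\<exists>n. C n = {}"
  proof (rule ccontr)
    assume ne: "\<nexists>n. C n = {}"
    have "(\<Inter>n. C n) \<noteq> {}"
    proof (rule compact_space_imp_nest[OF assms(1)])
      show "closedin X (C n)" for n
        unfolding C_def by (intro closedin_diff) auto
      show "C n \<noteq> {}" for n
        using ne by blast
      show "decseq C"
        unfolding C_def decseq_def
        by (intro allI impI Diff_mono closure_of_mono past_antimono) auto
    qed
    then obtain x where x: "\<And>n. x \<in> C n"
      by blast
    have "x \<in> X closure_of past t U" if "t \<in> nonneg T" for t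
    proof -
      obtain n where "t \<le> real n"
        using real_arch_simple by blast
      then have "past (real (Suc n)) U \<subseteq> past t U"
        by (intro past_antimono) auto
      then show ?thesis
        using x[of n] closure_of_mono by (fastforce simp: C_def)
    qed
    then have "x \<in> X interior_of U"
      using U by (auto simp: alpha_limit_eq)
    then show False
      using x[of 0] by (simp add: C_def)
  qed
  then obtain n where "C n = {}" ..
  then have "X closure_of past (real (Suc n)) U \<subseteq> X interior_of U"
    by (simp add: C_def)
  then show thesis
    using that[of "real (Suc n)"] of_nat_in_T[of "Suc n"] by simp
qed

lemma alpha_limit_in_Rep:
  assumes "compact_space X" "U \<in> RNbhd T X \<phi>"
  shows "alpha_limit T X \<phi> U \<in> Rep T X \<phi>"
proof -
  have U: "U \<subseteq> topspace X"
    using assms by (simp add: RNbhd_def)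
  obtain t where t: "t \<in> T" "0 < t" and cl: "X closure_of past t U \<subseteq> X interior_of U"
    using compact_past_in_interior[OF assms] .
  define V where "V = past t U"
  have V: "V \<subseteq> topspace X" "V \<subseteq> U"
    using cl closure_of_subset[OF past_subset_topspace, of t U] interior_of_subset[of X U]
      past_subset_topspace[of t U] by (auto simp: V_def)
  \<comment> \<open>If \<open>\<phi> r x\<close> visits \<open>U\<close> at a time
    \<open>s \<ge> t\<close>, then \<open>x\<close> visits \<open>U\<close> at the still later time
    \<open>s + r\<close>.\<close>
  have "backward_invariant T X \<phi> V"
    unfolding backward_invariant_iff
  proof (intro conjI ballI impI)
    fix r x assume r: "r \<in> T" "0 \<le> r" and x: "x \<in> topspace X" "\<phi> r x \<in> V"
    then obtain s where s: "s \<in> T" "t \<le> s" "\<phi> s (\<phi> r x) \<in> U"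
      by (auto simp: V_def past_def)
    then have "\<phi> (s + r) x \<in> U" "s + r \<in> T" "t \<le> s + r"
      using flow_flow[of r s x] r x t by (auto simp: add_in_T)
    then show "x \<in> V"
      using x by (auto simp: V_def past_def)
  qed (rule V)
  \<comment> \<open>The points that \<open>\<phi> t\<close> sends into the interior of
    \<open>U\<close> form an open subset of \<open>V\<close>, hence lie in the interior of
    \<open>V\<close>. Since the closure of \<open>V\<close> lies in the interior of
    \<open>U\<close>, its preimage under \<open>\<phi> t\<close> consists of such points.\<close>
  moreover have "set_flow X \<phi> (- t) (X closure_of V) \<subseteq> X interior_of V"
  proof -
    have "openin X {x \<in> topspace X. \<phi> t x \<in> X interior_of U}"
      using continuous_map_flow[of t] t by (intro openin_continuous_map_preimage) auto
    moreover have "{x \<in> topspace X. \<phi> t x \<in> X interior_of U} \<subseteq> V"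
      using t interior_of_subset[of X U] by (auto simp: V_def past_def)
    ultimately have "{x \<in> topspace X. \<phi> t x \<in> X interior_of U} \<subseteq> X interior_of V"
      by (simp add: interior_of_maximal)
    then show ?thesis
      using cl t by (auto simp: set_flow_def V_def)
  qed
  ultimately have "repelling_region T X \<phi> V"
    unfolding repelling_region_def using t minus_in_T[of t] by force
  moreover have "Inv_plus T X \<phi> V = alpha_limit T X \<phi> U"
  proof
    show "Inv_plus T X \<phi> V \<subseteq> alpha_limit T X \<phi> U"
      using V U by (auto simp: alpha_limit_eq_Inv_plus[OF assms(2)] Inv_plus_eq)
    \<comment> \<open>A point of \<open>Inv_plus T X \<phi> U\<close> is in \<open>U\<close> at time
      \<open>t\<close> in particular.\<close>
    have "alpha_limit T X \<phi> U \<subseteq> V"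
      using t U by (auto simp: alpha_limit_eq_Inv_plus[OF assms(2)] Inv_plus_eq V_def past_def)
    then show "alpha_limit T X \<phi> U \<subseteq> Inv_plus T X \<phi> V"
      using forward_invariant_alpha_limit[OF U] unfolding Inv_plus_def by blast
  qed
  ultimately show ?thesis
    unfolding Rep_def by blast
qed

text \<open>For surjectivity, a repeller \<open>Inv_plus T X \<phi> U\<close> comes from a repelling
  region \<open>U\<close>, which is a repelling neighborhood, so it equals \<alpha>(U).\<close>

lemma alpha_limit_image_RNbhd:
  assumes "compact_space X"
  shows "alpha_limit T X \<phi> ` RNbhd T X \<phi> = Rep T X \<phi>"
proof
  show "alpha_limit T X \<phi> ` RNbhd T X \<phi> \<subseteq> Rep T X \<phi>"
    using alpha_limit_in_Rep[OF assms] by blast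
  show "Rep T X \<phi> \<subseteq> alpha_limit T X \<phi> ` RNbhd T X \<phi>"
    using repelling_region_imp_RNbhd alpha_limit_eq_Inv_plus unfolding Rep_def by force
qed

section \<open>Lattice structure\<close>

lemma RNbhd_Un:
  assumes "U \<in> RNbhd T X \<phi>" "V \<in> RNbhd T X \<phi>"
  shows "U \<union> V \<in> RNbhd T X \<phi>"
  using assms interior_of_mono[of U "U \<union> V" X] interior_of_mono[of V "U \<union> V" X]
  by (auto simp: RNbhd_def alpha_limit_Un)

text \<open>Monotonicity puts the limit set of \<open>U \<inter> V\<close> in both interiors, and
  interior commutes with finite intersections.\<close>

lemma RNbhd_Int:
  assumes "U \<in> RNbhd T X \<phi>" "V \<in> RNbhd T X \<phi>"
  shows "U \<inter> V \<in> RNbhd T X \<phi>"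
  using assms alpha_limit_mono[of "U \<inter> V" U] alpha_limit_mono[of "U \<inter> V" V]
  by (auto simp: RNbhd_def interior_of_Int)

text \<open>All three limit sets are described by \<open>Inv_plus\<close>, whose condition is
  universal over time and so splits over an intersection.\<close>

lemma alpha_limit_Int:
  assumes "U \<in> RNbhd T X \<phi>" "V \<in> RNbhd T X \<phi>"
  shows "alpha_limit T X \<phi> (U \<inter> V) = alpha_limit T X \<phi> U \<inter> alpha_limit T X \<phi> V"
proof -
  have "U \<subseteq> topspace X" "V \<subseteq> topspace X"
    using assms by (auto simp: RNbhd_def)
  then show ?thesis
    using assms RNbhd_Int[OF assms] by (auto simp: alpha_limit_eq_Inv_plus Inv_plus_eq le_infI1)
qed

lemma set_lattice_RNbhd: "set_lattice (topspace X) (RNbhd T X \<phi>)"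
proof -
  have "{} \<in> RNbhd T X \<phi>" "topspace X \<in> RNbhd T X \<phi>"
    by (auto simp: RNbhd_def alpha_limit_empty alpha_limit_topspace)
  then show ?thesis
    using RNbhd_Un RNbhd_Int by (auto simp: set_lattice_def RNbhd_def)
qed

text \<open>Combining both invariances into one equivalence makes closure under union and
  intersection purely propositional.\<close>

lemma Invset_pm_iff:
  "S \<in> Invset_pm T X \<phi> \<longleftrightarrow>
     S \<subseteq> topspace X \<and> (\<forall>t \<in> T. 0 \<le> t \<longrightarrow> (\<forall>x \<in> topspace X. \<phi> t x \<in> S \<longleftrightarrow> x \<in> S))"
  unfolding Invset_pm_def mem_Collect_eq forward_invariant_iff backward_invariant_iff
  by (meson subsetD)

lemma set_lattice_Invset_pm: "set_lattice (topspace X) (Invset_pm T X \<phi>)"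
  unfolding set_lattice_def
proof (intro conjI ballI)
  show "Invset_pm T X \<phi> \<subseteq> Pow (topspace X)"
    by (auto simp: Invset_pm_iff)
  show "{} \<in> Invset_pm T X \<phi>" "topspace X \<in> Invset_pm T X \<phi>"
    by (simp_all add: Invset_pm_iff flow_in_topspace)
  fix A B assume "A \<in> Invset_pm T X \<phi>" "B \<in> Invset_pm T X \<phi>"
  then show "A \<union> B \<in> Invset_pm T X \<phi>" "A \<inter> B \<in> Invset_pm T X \<phi>"
    by (simp_all add: Invset_pm_iff le_infI1)
qed

text \<open>The lattice operations are transported along \<alpha>: repellers are lifted to repelling
  neighborhoods, combined there, and mapped back.\<close>

lemma set_lattice_Rep:
  assumes "compact_space X"
  shows "set_lattice (topspace X) (Rep T X \<phi>)"
  unfolding set_lattice_def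
proof (intro conjI ballI)
  note image = alpha_limit_image_RNbhd[OF assms]
  show "Rep T X \<phi> \<subseteq> Pow (topspace X)"
    using alpha_limit_in_Invset_pm set_lattice_Invset_pm
    unfolding set_lattice_def image[symmetric] by blast
  show "{} \<in> Rep T X \<phi>" "topspace X \<in> Rep T X \<phi>"
    using set_lattice_RNbhd alpha_limit_empty alpha_limit_topspace
    unfolding set_lattice_def image[symmetric] by (metis imageI)+
  fix A B assume "A \<in> Rep T X \<phi>" "B \<in> Rep T X \<phi>"
  then obtain U V where UV: "U \<in> RNbhd T X \<phi>" "V \<in> RNbhd T X \<phi>"
    and AB: "A = alpha_limit T X \<phi> U" "B = alpha_limit T X \<phi> V"
    unfolding image[symmetric] by blast
  have "A \<union> B = alpha_limit T X \<phi> (U \<union> V)"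
    using UV unfolding AB by (subst alpha_limit_Un) (auto simp: RNbhd_def)
  then show "A \<union> B \<in> Rep T X \<phi>"
    using RNbhd_Un[OF UV] image by blast
  have "A \<inter> B = alpha_limit T X \<phi> (U \<inter> V)"
    using UV unfolding AB by (simp add: alpha_limit_Int)
  then show "A \<inter> B \<in> Rep T X \<phi>"
    using RNbhd_Int[OF UV] image by blast
qed

lemma set_sublattice_Rep:
  assumes "compact_space X"
  shows "set_sublattice (topspace X) (Rep T X \<phi>) (Invset_pm T X \<phi>)"
  unfolding set_sublattice_def
  using set_lattice_Invset_pm set_lattice_Rep[OF assms] alpha_limit_in_Invset_pm
  by (auto simp: alpha_limit_image_RNbhd[OF assms, symmetric])

lemma set_lattice_hom_alpha_limit:
  assumes "compact_space X"
  shows "set_lattice_hom (topspace X) (RNbhd T X \<phi>) (Rep T X \<phi>) (alpha_limit T X \<phi>)"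
proof -
  have "alpha_limit T X \<phi> (A \<union> B) = alpha_limit T X \<phi> A \<union> alpha_limit T X \<phi> B"
    if "A \<in> RNbhd T X \<phi>" "B \<in> RNbhd T X \<phi>" for A B
    using that alpha_limit_Un by (simp add: RNbhd_def)
  then show ?thesis
    unfolding set_lattice_hom_def
    using set_lattice_RNbhd set_lattice_Rep[OF assms] alpha_limit_in_Rep[OF assms]
      alpha_limit_Int alpha_limit_empty alpha_limit_topspace by blast
qed

end

theorem proposition4p4:
  fixes T :: "real set" and M :: "'a set" and d :: "'a \<Rightarrow> 'a \<Rightarrow> real"
    and X :: "'a topology" and \<phi> :: "real \<Rightarrow> 'a \<Rightarrow> 'a"
  assumes "T = \<int> \<or> T = UNIV"
    and "Metric_space M d"
    and "X = Metric_space.mtopology M d"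
    and "compact_space X"
    and "dynamical_system T X \<phi>"
  shows "set_sublattice M (Rep T X \<phi>) (Invset_pm T X \<phi>) \<and>
         set_lattice_hom M (RNbhd T X \<phi>) (Rep T X \<phi>) (alpha_limit T X \<phi>) \<and>
         alpha_limit T X \<phi> ` RNbhd T X \<phi> = Rep T X \<phi>"
proof -
  interpret dyn_system T X \<phi>
  proof
    show "s + t \<in> T" if "s \<in> T" "t \<in> T" for s t
      using assms(1) that by (metis Ints_add UNIV_I)
    show "- t \<in> T" if "t \<in> T" for t
      using assms(1) that by (metis Ints_minus UNIV_I)
    show "0 \<in> T" "1 \<in> T"
      using assms(1) by (metis Ints_0 UNIV_I, metis Ints_1 UNIV_I)
  qed (rule assms(5))
  have "topspace X = M"
    using assms(2,3) by (simp add: Metric_space.topspace_mtopology)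
  then show ?thesis
    using set_sublattice_Rep set_lattice_hom_alpha_limit alpha_limit_image_RNbhd assms(4) by blast
qed

end
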